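(* Assume the continuous nondegeneracy condition $$|(f(t),\omega)_{L^2}|\ge\kappa_0>0,\qquad0\le t\le T.$$ Suppose further that $$\left|\langle F^{n+\frac12},\boldsymbol\omega\rangle_h-(f(t_{n+\frac12}),\omega)_{L^2}\right|\le C_Qh^2$$ uniformly in $n$, and that $$\sup_{n,h}\|F^{n+\frac12}\|_h\le C_F,\qquad\sup_h\|A_h\boldsymbol\omega\|_h\le C_\omega .$$ Let $S^{n+\frac12}=\left(I+\frac\tau2A_h\right)^{-1}F^{n+\frac12}$ and $d_h^{n+\frac12}=\langle S^{n+\frac12},\boldsymbol\omega\rangle_h$. Then $$\left|d_h^{n+\frac12}-(f(t_{n+\frac12}),\omega)_{L^2}\right|\le C_Qh^2+\frac\tau2C_FC_\omega .$$ Consequently, if $h$ and $\tau$ are sufficiently small so that $$C_Qh^2+\frac\tau2C_FC_\omega\le\frac{\kappa_0}2,$$ then $$|d_h^{n+\frac12}|\ge\frac{\kappa_0}2=:\kappa>0,\qquad n=0,\dots,M-1.$$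
   Context: Let $l,T>0$, $0<s<1$. For integers $N\ge2$, $M\ge1$ put $h=l/N$, $x_i=ih$, $\tau=T/M$, $t_n=n\tau$, $t_{n+\frac12}=(t_n+t_{n+1})/2$. $f$ is a given real function on $[0,T]\times(0,l)$, $f(t)=f(t,\cdot)$, and $\omega$ a given observation weight on $(0,l)$, both with well-defined point values; $(\cdot,\cdot)_{L^2}$ is the $L^2(0,l)$ inner product. $F^{n+\frac12}=(f(t_{n+\frac12},x_i))_{i=1}^{N-1}$ and $\boldsymbol\omega=(\omega(x_i))_{i=1}^{N-1}$. On $\mathbb R^{N-1}$: $\langle v,z\rangle_h=h\sum_{i=1}^{N-1}v_iz_i$, $\|v\|_h^2=\langle v,v\rangle_h$. $L_h=\frac1{h^2}\,\mathrm{tridiag}(-1,2,-1)\in\mathbb R^{(N-1)\times(N-1)}$ has the spectral decomposition $L_h=Q\Lambda_hQ^T$ with $Q_{ik}=\sqrt{2/N}\,\sin(ik\pi/N)$, $\Lambda_h=\mathrm{diag}(\lambda_{k,h})$, $\lambda_{k,h}=\frac4{h^2}\sin^2\left(\frac{k\pi}{2N}\right)$, and $A_h:=L_h^s=Q\Lambda_h^sQ^T$ (symmetric positive definite). The constants $\kappa_0,C_Q,C_F,C_\omega$ are independent of $h$, $\tau$ and $n$. *)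

theory Defs
  imports
    "HOL-Analysis.Lebesgue_Measure"
    "Jordan_Normal_Form.Matrix"
    "Jordan_Normal_Form.Gauss_Jordan_Elimination"
begin

text \<open>Vectors and matrices are those of Jordan_Normal_Form, with runtime dimension \<open>N - 1\<close>.
  Their indices start at 0, so the mathematical index \<open>i \<in> {1..N-1}\<close> is the position \<open>i - 1\<close>.\<close>

definition mesh :: "real \<Rightarrow> nat \<Rightarrow> real" where
  "mesh l N = l / real N"

definition time_step :: "real \<Rightarrow> nat \<Rightarrow> real" where
  "time_step T M = T / real M"

definition grid_point :: "real \<Rightarrow> nat \<Rightarrow> nat \<Rightarrow> real" where
  "grid_point l N i = real i * mesh l N"

definition time_level :: "real \<Rightarrow> nat \<Rightarrow> nat \<Rightarrow> real" where
  "time_level T M n = real n * time_step T M"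

definition time_mid :: "real \<Rightarrow> nat \<Rightarrow> nat \<Rightarrow> real" where
  "time_mid T M n = (time_level T M n + time_level T M (n + 1)) / 2"

definition L2_fun :: "real \<Rightarrow> (real \<Rightarrow> real) \<Rightarrow> bool" where
  "L2_fun l g \<longleftrightarrow> g \<in> borel_measurable (lebesgue_on {0<..<l}) \<and>
                 integrable (lebesgue_on {0<..<l}) (\<lambda>x. (g x)\<^sup>2)"

definition L2_inner :: "real \<Rightarrow> (real \<Rightarrow> real) \<Rightarrow> (real \<Rightarrow> real) \<Rightarrow> real" where
  "L2_inner l g w = integral\<^sup>L (lebesgue_on {0<..<l}) (\<lambda>x. g x * w x)"

definition grid_fun :: "real \<Rightarrow> nat \<Rightarrow> (real \<Rightarrow> real) \<Rightarrow> real vec" where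
  "grid_fun l N g = Matrix.vec (N - 1) (\<lambda>i. g (grid_point l N (i + 1)))"

definition inner_h :: "real \<Rightarrow> nat \<Rightarrow> real vec \<Rightarrow> real vec \<Rightarrow> real" where
  "inner_h l N v z = mesh l N * scalar_prod v z"

definition norm_h :: "real \<Rightarrow> nat \<Rightarrow> real vec \<Rightarrow> real" where
  "norm_h l N v = sqrt (inner_h l N v v)"

definition discr_laplace :: "real \<Rightarrow> nat \<Rightarrow> real mat" where
  "discr_laplace l N = (1 / (mesh l N)\<^sup>2) \<cdot>\<^sub>m
     Matrix.mat (N - 1) (N - 1) (\<lambda>(i, j). if i = j then 2 else if i = j + 1 \<or> j = i + 1 then - 1 else 0)"

definition eigvec_mat :: "nat \<Rightarrow> real mat" where
  "eigvec_mat N = Matrix.mat (N - 1) (N - 1)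
     (\<lambda>(i, k). sqrt (2 / real N) * sin (real (i + 1) * real (k + 1) * pi / real N))"

definition eigval :: "real \<Rightarrow> nat \<Rightarrow> nat \<Rightarrow> real" where
  "eigval l N k = 4 / (mesh l N)\<^sup>2 * (sin (real k * pi / (2 * real N)))\<^sup>2"

text \<open>\<open>frac_laplace l N s\<close> is the spectral power \<open>L\<^sub>h\<^sup>s\<close>; the lemmas below show that
  the columns of \<open>eigvec_mat\<close> form an orthonormal eigenbasis of \<open>discr_laplace\<close>.\<close>

definition frac_laplace :: "real \<Rightarrow> nat \<Rightarrow> real \<Rightarrow> real mat" where
  "frac_laplace l N s =
     eigvec_mat N * mat_diag (N - 1) (\<lambda>k. eigval l N (k + 1) powr s) * transpose_mat (eigvec_mat N)"

text \<open>\<open>mat_inverse\<close> returns an option; the matrix inverted here is nonsingular for \<open>\<tau> > 0\<close>.\<close>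

definition source_vec :: "real \<Rightarrow> real \<Rightarrow> real \<Rightarrow> nat \<Rightarrow> nat \<Rightarrow> (real \<Rightarrow> real \<Rightarrow> real) \<Rightarrow> nat \<Rightarrow> real vec" where
  "source_vec l T s N M f n =
     the (mat_inverse (1\<^sub>m (N - 1) + (time_step T M / 2) \<cdot>\<^sub>m frac_laplace l N s))
       *\<^sub>v grid_fun l N (f (time_mid T M n))"

definition denom_h ::
    "real \<Rightarrow> real \<Rightarrow> real \<Rightarrow> nat \<Rightarrow> nat \<Rightarrow> (real \<Rightarrow> real \<Rightarrow> real) \<Rightarrow> (real \<Rightarrow> real) \<Rightarrow> nat \<Rightarrow> real" where
  "denom_h l T s N M f w n = inner_h l N (source_vec l T s N M f n) (grid_fun l N w)"

lemma sum_cos_grid: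
  fixes m N :: nat
  assumes "0 < m" "m < 2 * N"
  shows "2 * (\<Sum>k=1..<N. cos (real k * real m * pi / real N)) = - 1 - (- 1) ^ m"
proof -
  have N: "N > 0" using assms by auto
  define p where "p = real m * pi / real N"
  have p: "0 < p / 2" "p / 2 < pi" using assms N by (auto simp: p_def field_simps)
  then have s: "sin (p / 2) > 0" by (rule sin_gt_zero)
  have tel: "2 * sin (p/2) * (\<Sum>k=1..<n. cos (real k * p)) = sin ((real n - 1/2) * p) - sin (p/2)"
    if "n \<ge> 1" for n
    using that
  proof (induction n rule: dec_induct)
    case base
    then show ?case by simp
  next
    case (step n)
    have "2 * sin (p/2) * cos (real n * p) = sin (real n * p + p/2) - sin (real n * p - p/2)"
      by (simp add: sin_add sin_diff)
    moreover have "real n * p + p/2 = (real (Suc n) - 1/2) * p" "real n * p - p/2 = (real n - 1/2) * p"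
      by (auto simp: algebra_simps)
    ultimately show ?case using step by (simp add: algebra_simps)
  qed
  have "(real N - 1/2) * p = real m * pi - p / 2"
    using N by (simp add: p_def field_simps)
  then have "sin ((real N - 1/2) * p) = - ((- 1) ^ m) * sin (p/2)"
    by (simp add: sin_diff)
  with tel[of N] N have "sin (p/2) * (2 * (\<Sum>k=1..<N. cos (real k * p))) = sin (p/2) * (- 1 - (- 1) ^ m)"
    by (simp add: algebra_simps)
  with s show ?thesis by (simp add: p_def mult.assoc)
qed

lemma sin_grid_orthogonal:
  fixes i j N :: nat
  assumes "i \<le> N" "0 < j" "j < N"
  shows "(\<Sum>k=1..<N. sin (real i * real k * pi / real N) * sin (real j * real k * pi / real N))
         = (if i = j then real N / 2 else 0)"
proof -
  define C where "C m = (\<Sum>k=1..<N. cos (real k * real m * pi / real N))" for m :: nat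
  define d where "d = (if i \<le> j then j - i else i - j)"
  have "2 * (sin (real i * real k * pi / real N) * sin (real j * real k * pi / real N)) =
        cos (real k * real d * pi / real N) - cos (real k * real (i + j) * pi / real N)" for k
  proof -
    have e: "real k * real (i + j) * pi / real N = real i * real k * pi / real N + real j * real k * pi / real N"
      by (simp add: add_divide_distrib algebra_simps)
    have "real k * real d * pi / real N = (if i \<le> j then real j * real k * pi / real N - real i * real k * pi / real N
             else real i * real k * pi / real N - real j * real k * pi / real N)"
      by (auto simp: d_def of_nat_diff diff_divide_distrib algebra_simps)
    then show ?thesis unfolding e by (auto simp: cos_add cos_diff)
  qed
  then have *: "2 * (\<Sum>k=1..<N. sin (real i * real k * pi / real N) * sin (real j * real k * pi / real N)) = C d - C (i + j)"
    unfolding C_def sum_distrib_left sum_subtractf[symmetric] by (intro sum.cong) auto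
  have ij: "2 * C (i + j) = - 1 - (- 1) ^ (i + j)"
    unfolding C_def by (rule sum_cos_grid) (use assms in auto)
  show ?thesis
  proof (cases "i = j")
    case True
    have "C d = real N - 1" using True assms by (simp add: C_def d_def of_nat_diff)
    moreover have "C (i + j) = - 1" using ij True by simp
    ultimately show ?thesis using * True by simp
  next
    case False
    have "2 * C d = - 1 - (- 1) ^ d"
      unfolding C_def by (rule sum_cos_grid) (use assms False in \<open>auto simp: d_def\<close>)
    moreover have "even d = even (i + j)" by (auto simp: d_def)
    then have "(- 1 :: real) ^ d = (- 1) ^ (i + j)" by (simp add: uminus_power_if)
    ultimately show ?thesis using * ij False by simp
  qed
qed

lemma eigvec_mat_orthogonal:
  "eigvec_mat N * transpose_mat (eigvec_mat N) = 1\<^sub>m (N - 1)"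
proof (rule eq_matI)
  fix i j assume "i < dim_row (1\<^sub>m (N - 1) :: real mat)" "j < dim_col (1\<^sub>m (N - 1) :: real mat)"
  then have ij: "i < N - 1" "j < N - 1" by auto
  have sq: "sqrt (2 / real N) * a * (sqrt (2 / real N) * b) = (2 / real N) * (a * b)" for a b
    using real_sqrt_mult_self[of "2 / real N"] by (metis abs_of_nonneg divide_nonneg_nonneg mult.assoc mult.left_commute of_nat_0_le_iff zero_le_numeral)
  have "(eigvec_mat N * transpose_mat (eigvec_mat N)) $$ (i, j) =
    (\<Sum>k=0..<N-1. (2 / real N) * (sin (real (i+1) * real (k+1) * pi / real N) * sin (real (j+1) * real (k+1) * pi / real N)))"
    using ij by (simp add: eigvec_mat_def scalar_prod_def sq del: real_sqrt_divide real_sqrt_mult)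
  also have "\<dots> = (2 / real N) * (\<Sum>k=1..<N. sin (real (i+1) * real k * pi / real N) * sin (real (j+1) * real k * pi / real N))"
    unfolding sum_distrib_left
    by (rule sum.reindex_bij_witness[of _ "\<lambda>k. k - 1" Suc]) auto
  also have "\<dots> = (1\<^sub>m (N - 1) :: real mat) $$ (i, j)"
    using ij by (subst sin_grid_orthogonal) auto
  finally show "(eigvec_mat N * transpose_mat (eigvec_mat N)) $$ (i, j) = (1\<^sub>m (N - 1) :: real mat) $$ (i, j)" .
qed (auto simp: eigvec_mat_def)

lemma discr_laplace_spectral:
  "discr_laplace l N =
     eigvec_mat N * mat_diag (N - 1) (\<lambda>k. eigval l N (k + 1)) * transpose_mat (eigvec_mat N)"
    (is "_ = ?R")
proof (rule eq_matI)
  fix i j assume "i < dim_row ?R" "j < dim_col ?R"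
  then have ij: "i < N - 1" "j < N - 1" by (auto simp: eigvec_mat_def)
  define S where "S a k = sin (real a * real k * pi / real N)" for a k :: nat
  define c where "c = 1 / (mesh l N)\<^sup>2"
  have ev: "eigval l N k * S (i + 1) k = c * (2 * S (i + 1) k - S i k - S (i + 2) k)" for k
  proof -
    define x where "x = real k * pi / real N"
    have h: "real k * pi / (2 * real N) = x / 2" by (simp add: x_def)
    have e1: "2 * (sin (x / 2))\<^sup>2 = 1 - cos x" using cos_double_sin[of "x / 2"] by simp
    have e: "S a k = sin (real a * x)" for a by (simp add: S_def x_def mult.assoc)
    have "real i * x = real (i + 1) * x - x" "real (i + 2) * x = real (i + 1) * x + x"
      by (auto simp: algebra_simps)
    then have e2: "S i k + S (i + 2) k = 2 * cos x * S (i + 1) k"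
      unfolding e by (simp only: sin_add sin_diff) simp
    have e3: "eigval l N k = c * (2 * (1 - cos x))"
      unfolding eigval_def h e1[symmetric] c_def by simp
    have "eigval l N k * S (i + 1) k = c * (2 * S (i + 1) k - (S i k + S (i + 2) k))"
      unfolding e2 e3 by (simp add: algebra_simps)
    then show ?thesis by (simp add: diff_diff_eq)
  qed
  have sq: "sqrt (2 / real N) * a * e * (sqrt (2 / real N) * b) = (2 / real N) * (e * a * b)" for a b e
  proof -
    have "sqrt (2 / real N) * a * e * (sqrt (2 / real N) * b) = (sqrt (2 / real N) * sqrt (2 / real N)) * (e * a * b)"
      by (simp only: ac_simps)
    then show ?thesis by (simp only: real_sqrt_mult_self) simp
  qed
  have "?R $$ (i, j) =
    (\<Sum>k=0..<N-1. (2 / real N) * (eigval l N (k + 1) * S (i+1) (k+1) * S (j+1) (k+1)))"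
    using ij by (subst mat_diag_mult_right[of _ "N - 1"])
      (simp_all add: eigvec_mat_def scalar_prod_def S_def sq del: real_sqrt_divide real_sqrt_mult)
  also have "\<dots> = (2 / real N) * (\<Sum>k=1..<N. eigval l N k * S (i+1) k * S (j+1) k)"
    unfolding sum_distrib_left
    by (rule sum.reindex_bij_witness[of _ "\<lambda>k. k - 1" Suc]) auto
  also have "\<dots> = (2 / real N) * c * (2 * (\<Sum>k=1..<N. S (i+1) k * S (j+1) k)
       - (\<Sum>k=1..<N. S i k * S (j+1) k) - (\<Sum>k=1..<N. S (i+2) k * S (j+1) k))"
    unfolding ev by (simp add: sum_distrib_left sum_subtractf sum.distrib algebra_simps)
  also have "\<dots> = discr_laplace l N $$ (i, j)"
    unfolding S_def using ij
    by (subst (1 2 3) sin_grid_orthogonal) (auto simp: discr_laplace_def c_def)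
  finally show "discr_laplace l N $$ (i, j) = ?R $$ (i, j)" ..
qed (auto simp: discr_laplace_def eigvec_mat_def)

end

theory Submission
  imports Defs "Jordan_Normal_Form.Determinant"
begin

text \<open>Write \<open>A\<close> for \<open>A\<^sub>h\<close>, \<open>c = \<tau>/2\<close> and \<open>S = (I + c A)\<inverse> F\<close>. Since \<open>A\<close> is positive semidefinite, pairing
  \<open>S + c A S = F\<close> with \<open>S\<close> gives \<open>\<parallel>S\<parallel> \<le> \<parallel>F\<parallel>\<close>; since \<open>A\<close> is symmetric,
  \<open>\<langle>F - S, \<omega>\<rangle> = c \<langle>A S, \<omega>\<rangle> = c \<langle>S, A \<omega>\<rangle>\<close>, which is at most \<open>c \<parallel>F\<parallel> \<parallel>A \<omega>\<parallel>\<close> by Cauchy--Schwarz.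
  Letting \<open>A\<close> act on the weight is what makes the bound uniform in \<open>h\<close>.\<close>

lemma scalar_prod_self_nonneg: "scalar_prod v v \<ge> (0 :: real)"
  by (simp add: scalar_prod_def sum_nonneg)

lemma scalar_prod_self_eq_0:
  fixes v :: "real vec"
  assumes "v \<in> carrier_vec n" "scalar_prod v v = 0"
  shows "v = 0\<^sub>v n"
  using assms by (intro eq_vecI) (auto simp: scalar_prod_def sum_nonneg_eq_0_iff)

text \<open>Passing to absolute values entrywise reduces the claim to
  \<open>L2_set_mult_ineq\<close>, since \<open>L2_set\<close> is the Euclidean norm of the
  entries.\<close>

lemma scalar_prod_Cauchy_Schwarz:
  fixes v w :: "real vec"
  assumes "v \<in> carrier_vec n" "w \<in> carrier_vec n"
  shows "\<bar>scalar_prod v w\<bar> \<le> sqrt (scalar_prod v v) * sqrt (scalar_prod w w)"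
proof -
  have "\<bar>scalar_prod v w\<bar> \<le> (\<Sum>i<n. \<bar>v $ i\<bar> * \<bar>w $ i\<bar>)"
    using assms sum_abs[of "\<lambda>i. v $ i * w $ i" "{..<n}"]
    by (simp add: scalar_prod_def abs_mult lessThan_atLeast0)
  also have "\<dots> \<le> L2_set (vec_index v) {..<n} * L2_set (vec_index w) {..<n}"
    by (rule L2_set_mult_ineq)
  also have "\<dots> = sqrt (scalar_prod v v) * sqrt (scalar_prod w w)"
    using assms by (simp add: scalar_prod_def L2_set_def power2_eq_square lessThan_atLeast0)
  finally show ?thesis .
qed

lemma symmetric_mat_scalar_prod:
  fixes A :: "real mat"
  assumes "A \<in> carrier_mat n n" "transpose_mat A = A" "v \<in> carrier_vec n" "w \<in> carrier_vec n"
  shows "scalar_prod (A *\<^sub>v v) w = scalar_prod v (A *\<^sub>v w)"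
  using transpose_vec_mult_scalar[of A n n w v] assms by simp

lemma transpose_spectral:
  fixes Q :: "real mat"
  assumes Q: "Q \<in> carrier_mat n n"
  shows "transpose_mat (Q * mat_diag n d * transpose_mat Q) = Q * mat_diag n d * transpose_mat Q"
proof -
  have D: "mat_diag n d \<in> carrier_mat n n" by simp
  have "transpose_mat (mat_diag n d) = mat_diag n d"
    by (rule eq_matI) (auto simp: mat_diag_def)
  moreover have QD: "Q * mat_diag n d \<in> carrier_mat n n" and QT: "transpose_mat Q \<in> carrier_mat n n"
    using Q by auto
  ultimately show ?thesis
    unfolding transpose_mult[OF QD QT] transpose_mult[OF Q D] transpose_transpose
    using assoc_mult_mat[OF Q D QT] by simp
qed

text \<open>In the coordinates \<open>z = transpose_mat Q *\<^sub>v v\<close> the quadratic form is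
  the weighted sum of squares of the \<open>z $ i\<close> with weights \<open>d i\<close>.\<close>

lemma spectral_nonneg:
  fixes Q :: "real mat"
  assumes Q: "Q \<in> carrier_mat n n" and v: "v \<in> carrier_vec n" and d: "\<And>i. i < n \<Longrightarrow> d i \<ge> 0"
  shows "scalar_prod v ((Q * mat_diag n d * transpose_mat Q) *\<^sub>v v) \<ge> 0"
proof -
  define D z where "D = mat_diag n d" and "z = transpose_mat Q *\<^sub>v v"
  have D: "D \<in> carrier_mat n n" and z: "z \<in> carrier_vec n"
    using Q v by (auto simp: D_def z_def)
  have QT: "transpose_mat Q \<in> carrier_mat n n" using Q by simp
  have QD: "Q * D \<in> carrier_mat n n" using Q D by simp
  have "(Q * D * transpose_mat Q) *\<^sub>v v = Q *\<^sub>v (D *\<^sub>v z)"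
    unfolding z_def assoc_mult_mat_vec[OF QD QT v] using Q D z
    by (simp add: z_def)
  then have "scalar_prod v ((Q * D * transpose_mat Q) *\<^sub>v v) = scalar_prod z (D *\<^sub>v z)"
    using transpose_vec_mult_scalar[of Q n n "D *\<^sub>v z" v] Q D z v by (simp add: z_def)
  also have "\<dots> = (\<Sum>i<n. d i * (z $ i)\<^sup>2)"
  proof -
    have "(D *\<^sub>v z) $ i = d i * z $ i" if "i < n" for i
    proof -
      have "(D *\<^sub>v z) $ i = (\<Sum>j<n. (if i = j then d j else 0) * z $ j)"
        using that z by (simp add: D_def mat_diag_def scalar_prod_def lessThan_atLeast0)
      also have "\<dots> = (\<Sum>j<n. if i = j then d j * z $ j else 0)"
        by (intro sum.cong) auto
      finally show ?thesis using that by simp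
    qed
    then show ?thesis
      using D by (simp add: scalar_prod_def lessThan_atLeast0 power2_eq_square ac_simps)
  qed
  also have "\<dots> \<ge> 0" using d by (intro sum_nonneg) auto
  finally show ?thesis by (simp add: D_def)
qed

lemma one_add_smult_mult_vec:
  fixes A :: "real mat"
  assumes "A \<in> carrier_mat n n" "v \<in> carrier_vec n"
  shows "(1\<^sub>m n + c \<cdot>\<^sub>m A) *\<^sub>v v = v + c \<cdot>\<^sub>v (A *\<^sub>v v)"
proof -
  have "(c \<cdot>\<^sub>m A) *\<^sub>v v = c \<cdot>\<^sub>v (A *\<^sub>v v)"
    using assms by (intro eq_vecI) auto
  then show ?thesis
    using assms by (simp add: add_mult_distrib_mat_vec[of _ n n])
qed

text \<open>Pairing \<open>?B *\<^sub>v v = 0\<close> with \<open>v\<close> gives a vanishing sum of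
  the nonnegative terms \<open>scalar_prod v v\<close> and
  \<open>c * scalar_prod v (A *\<^sub>v v)\<close>, so the kernel is trivial and the determinant
  nonzero. Hence \<open>the (mat_inverse ...)\<close> in \<open>source_vec\<close> denotes a genuine
  inverse.\<close>

lemma mat_inverse_psd_resolvent:
  fixes A :: "real mat"
  assumes A: "A \<in> carrier_mat n n"
    and psd: "\<And>v. v \<in> carrier_vec n \<Longrightarrow> scalar_prod v (A *\<^sub>v v) \<ge> 0"
    and c: "c \<ge> 0"
  obtains R where "mat_inverse (1\<^sub>m n + c \<cdot>\<^sub>m A) = Some R" "R \<in> carrier_mat n n"
    "(1\<^sub>m n + c \<cdot>\<^sub>m A) * R = 1\<^sub>m n"
proof -
  let ?B = "1\<^sub>m n + c \<cdot>\<^sub>m A"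
  have B: "?B \<in> carrier_mat n n" using A by simp
  have inj: "v = 0\<^sub>v n" if v: "v \<in> carrier_vec n" and 0: "?B *\<^sub>v v = 0\<^sub>v n" for v
  proof -
    have Av: "A *\<^sub>v v \<in> carrier_vec n" using A v by simp
    have "0 = scalar_prod v (v + c \<cdot>\<^sub>v (A *\<^sub>v v))"
      using 0 v one_add_smult_mult_vec[OF A v] by simp
    also have "\<dots> = scalar_prod v v + c * scalar_prod v (A *\<^sub>v v)"
      using v Av by (simp add: scalar_prod_add_distrib[of _ n])
    finally have "scalar_prod v v = 0"
      using psd[OF v] c scalar_prod_self_nonneg[of v] mult_nonneg_nonneg[of c "scalar_prod v (A *\<^sub>v v)"]
      by linarith
    with v show ?thesis by (rule scalar_prod_self_eq_0)
  qed
  then have "det ?B \<noteq> 0" using det_0_iff_vec_prod_zero[OF B] by blast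
  then have "?B \<in> Units (ring_mat TYPE(real) n ())" by (rule det_non_zero_imp_unit[OF B])
  then obtain R where "mat_inverse ?B = Some R"
    using mat_inverse(1)[OF B] by fastforce
  with mat_inverse(2)[OF B this] that show ?thesis by blast
qed

text \<open>The core estimate, kept free of the grid: the scalar product is unweighted, and the mesh
  factor is restored in \<open>denom_h_error\<close>.\<close>

lemma psd_resolvent_bound:
  fixes A :: "real mat"
  assumes A: "A \<in> carrier_mat n n" and sym: "transpose_mat A = A"
    and psd: "\<And>v. v \<in> carrier_vec n \<Longrightarrow> scalar_prod v (A *\<^sub>v v) \<ge> 0"
    and c: "c \<ge> 0" and F: "F \<in> carrier_vec n" and w: "w \<in> carrier_vec n"
  defines "S \<equiv> the (mat_inverse (1\<^sub>m n + c \<cdot>\<^sub>m A)) *\<^sub>v F"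
  shows "\<bar>scalar_prod S w - scalar_prod F w\<bar>
    \<le> c * (sqrt (scalar_prod F F) * sqrt (scalar_prod (A *\<^sub>v w) (A *\<^sub>v w)))"
proof -
  obtain R where R: "mat_inverse (1\<^sub>m n + c \<cdot>\<^sub>m A) = Some R" "R \<in> carrier_mat n n"
    "(1\<^sub>m n + c \<cdot>\<^sub>m A) * R = 1\<^sub>m n"
    using mat_inverse_psd_resolvent[OF A psd c] by blast
  have S: "S \<in> carrier_vec n" using R F by (simp add: S_def)
  have AS: "A *\<^sub>v S \<in> carrier_vec n" and Aw: "A *\<^sub>v w \<in> carrier_vec n" using A S w by auto
  \<comment> \<open>That \<open>R\<close> is a right inverse is exactly what makes \<open>S\<close>
    solve the implicit equation with right-hand side \<open>F\<close>.\<close>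
  have "(1\<^sub>m n + c \<cdot>\<^sub>m A) *\<^sub>v S = ((1\<^sub>m n + c \<cdot>\<^sub>m A) * R) *\<^sub>v F"
    unfolding S_def R(1) option.sel
    by (rule assoc_mult_mat_vec[of _ n n, symmetric, OF _ R(2) F]) (use A in simp)
  also have "\<dots> = F" unfolding R(3) using F by simp
  finally have F_eq: "S + c \<cdot>\<^sub>v (A *\<^sub>v S) = F"
    unfolding one_add_smult_mult_vec[OF A S] .
  \<comment> \<open>The test vector stays free because two choices are needed: \<open>S\<close> for
    the contraction and \<open>w\<close> for the error identity.\<close>
  have F_prod: "scalar_prod F v = scalar_prod S v + c * scalar_prod (A *\<^sub>v S) v"
    if "v \<in> carrier_vec n" for v
    using that S AS unfolding F_eq[symmetric] by (simp add: add_scalar_prod_distrib[of _ n])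
  let ?s = "sqrt (scalar_prod S S)" and ?F = "sqrt (scalar_prod F F)"
  have s2: "?s * ?s = scalar_prod S S" using scalar_prod_self_nonneg[of S] by simp
  have "scalar_prod (A *\<^sub>v S) S \<ge> 0"
    using psd[OF S] comm_scalar_prod[OF S AS] by simp
  then have "?s * ?s \<le> scalar_prod F S"
    using F_prod[OF S] c s2 mult_nonneg_nonneg[of c "scalar_prod (A *\<^sub>v S) S"] by linarith
  also have "\<dots> \<le> ?F * ?s"
    using scalar_prod_Cauchy_Schwarz[OF F S] by linarith
  finally have "?s * ?s \<le> ?F * ?s" .
  moreover have "?s \<ge> 0" "?F \<ge> 0" by (simp_all add: scalar_prod_self_nonneg)
  \<comment> \<open>The factor \<open>?s\<close> cancels when it is positive; when it is zero, the
    claim is just \<open>?F \<ge> 0\<close>.\<close>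
  ultimately have contraction: "?s \<le> ?F"
    by (metis mult_right_le_imp_le order_le_less)
  have "\<bar>scalar_prod S w - scalar_prod F w\<bar> = c * \<bar>scalar_prod S (A *\<^sub>v w)\<bar>"
    using F_prod[OF w] symmetric_mat_scalar_prod[OF A sym S w] c by (simp add: abs_mult)
  also have "\<dots> \<le> c * (?s * sqrt (scalar_prod (A *\<^sub>v w) (A *\<^sub>v w)))"
    using c scalar_prod_Cauchy_Schwarz[OF S Aw] by (intro mult_left_mono)
  also have "\<dots> \<le> c * (?F * sqrt (scalar_prod (A *\<^sub>v w) (A *\<^sub>v w)))"
    using c contraction by (intro mult_left_mono mult_right_mono) (auto simp: scalar_prod_self_nonneg)
  finally show ?thesis .
qed

lemma eigvec_mat_carrier: "eigvec_mat N \<in> carrier_mat (N - 1) (N - 1)"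
  by (simp add: eigvec_mat_def)

lemma frac_laplace_carrier: "frac_laplace l N s \<in> carrier_mat (N - 1) (N - 1)"
  using eigvec_mat_carrier[of N] by (auto simp: frac_laplace_def)

lemma grid_fun_carrier: "grid_fun l N g \<in> carrier_vec (N - 1)"
  by (simp add: grid_fun_def)

lemma denom_h_error:
  assumes "l > 0" "T > 0"
  shows "\<bar>denom_h l T s N M f w n
      - inner_h l N (grid_fun l N (f (time_mid T M n))) (grid_fun l N w)\<bar>
    \<le> time_step T M / 2 * (norm_h l N (grid_fun l N (f (time_mid T M n)))
        * norm_h l N (frac_laplace l N s *\<^sub>v grid_fun l N w))"
proof -
  define F W A c where "F = grid_fun l N (f (time_mid T M n))" and "W = grid_fun l N w"
    and "A = frac_laplace l N s" and "c = time_step T M / 2"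
  define S where "S = the (mat_inverse (1\<^sub>m (N - 1) + c \<cdot>\<^sub>m A)) *\<^sub>v F"
  \<comment> \<open>This covers \<open>N = 0\<close> and \<open>M = 0\<close> as well, where
    division by zero yields 0.\<close>
  have h: "mesh l N \<ge> 0" and c: "c \<ge> 0"
    using assms by (simp_all add: mesh_def c_def time_step_def)
  have bound: "\<bar>scalar_prod S W - scalar_prod F W\<bar>
      \<le> c * (sqrt (scalar_prod F F) * sqrt (scalar_prod (A *\<^sub>v W) (A *\<^sub>v W)))"
    unfolding S_def
  proof (rule psd_resolvent_bound)
    show "A \<in> carrier_mat (N - 1) (N - 1)" unfolding A_def by (rule frac_laplace_carrier)
    show "transpose_mat A = A"
      unfolding A_def frac_laplace_def by (rule transpose_spectral[OF eigvec_mat_carrier])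
    \<comment> \<open>The diagonal entries are real values of \<open>powr\<close>, hence
      nonnegative.\<close>
    show "scalar_prod v (A *\<^sub>v v) \<ge> 0" if "v \<in> carrier_vec (N - 1)" for v
      unfolding A_def frac_laplace_def by (rule spectral_nonneg[OF eigvec_mat_carrier that]) simp
  qed (unfold F_def W_def, rule c, rule grid_fun_carrier, rule grid_fun_carrier)
  have "\<bar>mesh l N * scalar_prod S W - mesh l N * scalar_prod F W\<bar>
      = mesh l N * \<bar>scalar_prod S W - scalar_prod F W\<bar>"
    using h by (simp add: abs_mult flip: right_diff_distrib)
  also have "\<dots> \<le> mesh l N * (c * (sqrt (scalar_prod F F) * sqrt (scalar_prod (A *\<^sub>v W) (A *\<^sub>v W))))"
    using bound h by (rule mult_left_mono)
  \<comment> \<open>The single mesh factor of the inner product is split into two square roots, one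
    for each discrete norm.\<close>
  also have "\<dots> = (sqrt (mesh l N) * sqrt (mesh l N))
      * (c * (sqrt (scalar_prod F F) * sqrt (scalar_prod (A *\<^sub>v W) (A *\<^sub>v W))))"
    using h by simp
  also have "\<dots> = c * (norm_h l N F * norm_h l N (A *\<^sub>v W))"
    unfolding norm_h_def inner_h_def real_sqrt_mult by (simp only: ac_simps)
  finally show ?thesis
    by (simp add: denom_h_def source_vec_def inner_h_def S_def F_def W_def A_def c_def)
qed

text \<open>Needed to apply the nondegeneracy condition, given only on the time interval, at the
  midpoints. The upper bound rests on \<open>n + 1/2 \<le> M\<close>, which holds because
  \<open>n < M\<close> are integers.\<close>

lemma time_mid_in_interval:
  assumes "T > 0" "n < M"
  shows "0 \<le> time_mid T M n" "time_mid T M n \<le> T"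
proof -
  have eq: "time_mid T M n = (real n + 1/2) * T / real M"
    using assms by (simp add: time_mid_def time_level_def time_step_def field_simps)
  show "0 \<le> time_mid T M n" using assms by (simp add: eq)
  have "(real n + 1/2) * T \<le> real M * T"
    using assms by (intro mult_right_mono) linarith+
  then show "time_mid T M n \<le> T" using assms by (simp add: eq field_simps)
qed

theorem lemma4p8:
  fixes l T s \<kappa>\<^sub>0 C\<^sub>Q C\<^sub>F C\<^sub>\<omega> :: real
    and f :: "real \<Rightarrow> real \<Rightarrow> real"
    and \<omega> :: "real \<Rightarrow> real"
  assumes "l > 0" and "T > 0" and "0 < s" and "s < 1"
    and "\<And>t. 0 \<le> t \<Longrightarrow> t \<le> T \<Longrightarrow> L2_fun l (f t)"
    and "L2_fun l \<omega>"
    and "\<kappa>\<^sub>0 > 0"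
    and nondegenerate: "\<And>t. 0 \<le> t \<Longrightarrow> t \<le> T \<Longrightarrow> \<bar>L2_inner l (f t) \<omega>\<bar> \<ge> \<kappa>\<^sub>0"
    and quadrature: "\<And>N M n. N \<ge> 2 \<Longrightarrow> M \<ge> 1 \<Longrightarrow> n < M \<Longrightarrow>
      \<bar>inner_h l N (grid_fun l N (f (time_mid T M n))) (grid_fun l N \<omega>)
        - L2_inner l (f (time_mid T M n)) \<omega>\<bar> \<le> C\<^sub>Q * (mesh l N)\<^sup>2"
    and source_bound: "\<And>N M n. N \<ge> 2 \<Longrightarrow> M \<ge> 1 \<Longrightarrow> n < M \<Longrightarrow>
      norm_h l N (grid_fun l N (f (time_mid T M n))) \<le> C\<^sub>F"
    and weight_bound: "\<And>N. N \<ge> 2 \<Longrightarrow>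
      norm_h l N (frac_laplace l N s *\<^sub>v grid_fun l N \<omega>) \<le> C\<^sub>\<omega>"
  shows "(\<forall>N\<ge>2. \<forall>M\<ge>1. \<forall>n<M.
            \<bar>denom_h l T s N M f \<omega> n - L2_inner l (f (time_mid T M n)) \<omega>\<bar>
              \<le> C\<^sub>Q * (mesh l N)\<^sup>2 + time_step T M / 2 * C\<^sub>F * C\<^sub>\<omega>) \<and>
         (\<forall>N\<ge>2. \<forall>M\<ge>1.
            C\<^sub>Q * (mesh l N)\<^sup>2 + time_step T M / 2 * C\<^sub>F * C\<^sub>\<omega> \<le> \<kappa>\<^sub>0 / 2 \<longrightarrow>
            \<kappa>\<^sub>0 / 2 > 0 \<and> (\<forall>n<M. \<bar>denom_h l T s N M f \<omega> n\<bar> \<ge> \<kappa>\<^sub>0 / 2))"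
proof -
  let ?err = "\<lambda>N M. C\<^sub>Q * (mesh l N)\<^sup>2 + time_step T M / 2 * C\<^sub>F * C\<^sub>\<omega>"
  have error: "\<bar>denom_h l T s N M f \<omega> n - L2_inner l (f (time_mid T M n)) \<omega>\<bar> \<le> ?err N M"
    if N: "N \<ge> 2" and M: "M \<ge> 1" and n: "n < M" for N M n
  proof -
    let ?F = "norm_h l N (grid_fun l N (f (time_mid T M n)))"
    let ?W = "norm_h l N (frac_laplace l N s *\<^sub>v grid_fun l N \<omega>)"
    have nonneg: "norm_h l N v \<ge> 0" for v
      using \<open>l > 0\<close> by (simp add: norm_h_def inner_h_def mesh_def scalar_prod_self_nonneg)
    \<comment> \<open>Monotonicity of the product requires \<open>C\<^sub>F \<ge> 0\<close>, which
      follows because \<open>C\<^sub>F\<close> bounds a norm.\<close>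
    have "?F * ?W \<le> C\<^sub>F * C\<^sub>\<omega>"
      using source_bound[OF N M n] weight_bound[OF N]
      by (rule mult_mono) (rule order_trans[OF nonneg source_bound[OF N M n]], rule nonneg)
    then have "time_step T M / 2 * (?F * ?W) \<le> time_step T M / 2 * (C\<^sub>F * C\<^sub>\<omega>)"
      using \<open>T > 0\<close> by (intro mult_left_mono) (simp_all add: time_step_def)
    then have "time_step T M / 2 * (?F * ?W) \<le> time_step T M / 2 * C\<^sub>F * C\<^sub>\<omega>"
      by (simp only: mult.assoc)
    \<comment> \<open>Triangle inequality through the discrete pairing of the source with the
      weight: resolvent error plus quadrature error.\<close>
    with quadrature[OF N M n] denom_h_error[OF \<open>l > 0\<close> \<open>T > 0\<close>, of s N M f \<omega> n]
    show ?thesis by linarith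
  qed
  \<comment> \<open>Reverse triangle inequality: a quantity of size at least
    \<open>\<kappa>\<^sub>0\<close> is perturbed by at most half of
    \<open>\<kappa>\<^sub>0\<close>.\<close>
  moreover have "\<bar>denom_h l T s N M f \<omega> n\<bar> \<ge> \<kappa>\<^sub>0 / 2"
    if "N \<ge> 2" "M \<ge> 1" "n < M" "?err N M \<le> \<kappa>\<^sub>0 / 2" for N M n
    using error[OF that(1-3)] that(4) nondegenerate[OF time_mid_in_interval[OF \<open>T > 0\<close> that(3)]]
    by linarith
  ultimately show ?thesis using \<open>\<kappa>\<^sub>0 > 0\<close> by simp
qed

end
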